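(* Let $p$ be a prime, $b\ge1$, $q=p^b$, let $1\le k\le d-1$ be integers, $1\le u\le q-1$ an integer, and $\triangle=[0,d]$. Then $p_{d,[0,k],u}\ge p_{\triangle,u}$ as functions on $\mathbb{R}_{\ge0}$. (Here both $p_{d,[0,k],u}$ and $p_{\triangle,u}$ are convex functions by definition, i.e. it is understood that the slope sequences defining them are nondecreasing.)
   Context: Notation: $\mathbb{N}=\{0,1,2,\dots\}$; $[\cdot]$ is the floor, $\lceil\cdot\rceil$ the ceiling and $\{\cdot\}$ the fractional part; $1_P$ is $1$ if $P$ holds and $0$ otherwise. Write $u=u_0+u_1p+\cdots+u_{b-1}p^{b-1}$ with $0\le u_i\le p-1$. Twisted arithmetic polygon of $\triangle=[0,d]$: for $n\in\mathbb{N}$, $1\le i\le b$, let $\delta_{\in}^{(i)}(n)=1$ if there is $l\in\mathbb{N}$ with $l<d\{\frac nd\}$ and $pl\equiv n-u_{b-i}\pmod d$, and $\delta_{\in}^{(i)}(n)=0$ otherwise. Then $p_{\triangle,u}$ is the convex function on $\mathbb{R}_{\ge0}$ with value $0$ at $0$, linear between consecutive integers, whose slope on $[n,n+1]$ ($n\in\mathbb{N}$) is $$\omega_{\triangle,u}(n)=\frac1b\sum_{i=1}^b\Big(\Big\lceil\frac{(p-1)n+u_{b-i}}{d}\Big\rceil-\delta_{\in}^{(i)}(n)\Big).$$ Twisted arithmetic polygon of $\{d\}\cup[0,k]$: for integers $a$ let $r_a=d\{a/d\}$ (the residue of $a$ mod $d$ in $\{0,\dots,d-1\}$; in particular $r_{-1}=d-1$),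 and for $a\in\mathbb{N}$, $1\le i\le b$ let $r_{a,i}=d\{\frac{pa+u_{b-i}}{d}\}$. For $a\in\mathbb{N}$ define $$\varpi_{d,[0,k],u}(a)=\frac1b\sum_{i=1}^b\Big(\big[\tfrac{pa+u_{b-i}}{d}\big]-\big[\tfrac ad\big]+\big[\tfrac{r_{a,i}}{k}\big]-\big[\tfrac{r_a}{k}\big]\Big)+\frac1b\sum_{i=1}^b\sum_{j=0}^{r_a}\Big(1_{\{\frac{r_{j,i}}{k}\}>\{\frac{r_a}{k}\}}-1_{\{\frac{r_j}{k}\}>\{\frac{r_a}{k}\}}\Big)-\frac1b\sum_{i=1}^b\sum_{j=0}^{r_{a-1}}\Big(1_{\{\frac{r_{j,i}}{k}\}>\{\frac{r_{a-1}}{k}\}}-1_{\{\frac{r_j}{k}\}>\{\frac{r_{a-1}}{k}\}}\Big).$$ Then $p_{d,[0,k],u}$ is the convex function on $\mathbb{R}_{\ge0}$ with value $0$ at $0$, linear between consecutive integers, with slope $\varpi_{d,[0,k],u}(a)$ on $[a,a+1]$ for each $a\in\mathbb{N}$.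
   Formalization: The formal theorem adds the assumption that p does not divide d; without it the claim is false, e.g. p=2, b=3, d=2, k=1, u=1, where both slope sequences are nondecreasing but at x=2 the polygons take the values 2/3 < 1. *)

theory Defs
  imports "HOL-Analysis.Analysis" "HOL-Number_Theory.Cong"
begin

definition digit :: "nat \<Rightarrow> nat \<Rightarrow> nat \<Rightarrow> nat" where
  "digit p u i = (u div p ^ i) mod p"

lemma digit_less: "p > 0 \<Longrightarrow> digit p u i < p"
  by (simp add: digit_def)

lemma digit_expansion:
  assumes "u < p ^ b"
  shows "u = (\<Sum>i<b. digit p u i * p ^ i)"
proof -
  have "u mod p ^ n = (\<Sum>i<n. digit p u i * p ^ i)" for n
  proof (induction n)
    case (Suc n)
    have "u mod p ^ Suc n = p ^ n * (u div p ^ n mod p) + u mod p ^ n"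
      by (simp only: power_Suc2 mod_mult2_eq)
    then show ?case
      using Suc by (simp add: digit_def algebra_simps)
  qed simp
  from this[of b] show ?thesis
    using assms by simp
qed

text \<open>The residue \<open>r\<^sub>a = d {a/d}\<close> of an integer \<open>a\<close> modulo \<open>d\<close>, in \<open>{0, \<dots>, d - 1}\<close>.\<close>

definition res :: "nat \<Rightarrow> int \<Rightarrow> int" where
  "res d a = a mod int d"

lemma res_eq_frac:
  assumes "d > 0"
  shows "real_of_int (res d a) = real d * frac (real_of_int a / real d)"
proof -
  have "\<lfloor>real_of_int a / real d\<rfloor> = a div int d"
    using floor_divide_of_int_eq[of a "int d"] by simp
  moreover have "real_of_int a = real d * real_of_int (a div int d) + real_of_int (a mod int d)"
    by (metis mult_div_mod_eq of_int_add of_int_mult of_int_of_nat_eq)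
  ultimately show ?thesis
    using assms by (simp add: res_def frac_def field_simps)
qed

text \<open>The twisted residue \<open>r\<^sub>a\<^sub>,\<^sub>i = d {(p a + u\<^sub>b\<^sub>-\<^sub>i)/d}\<close>.\<close>

definition twisted_res :: "nat \<Rightarrow> nat \<Rightarrow> nat \<Rightarrow> nat \<Rightarrow> nat \<Rightarrow> int \<Rightarrow> int" where
  "twisted_res p b d u i a = res d (int p * a + int (digit p u (b - i)))"

text \<open>The function on the nonnegative reals with value \<open>0\<close> at \<open>0\<close> that is linear with slope
  \<open>s n\<close> on \<open>[n, n + 1]\<close>, for every natural number \<open>n\<close>. Its values at negative arguments are
  irrelevant.\<close>

definition polygon :: "(nat \<Rightarrow> real) \<Rightarrow> real \<Rightarrow> real" where
  "polygon s x = (\<Sum>n<nat \<lfloor>x\<rfloor>. s n) + frac x * s (nat \<lfloor>x\<rfloor>)"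

lemma polygon_0: "polygon s 0 = 0"
  by (simp add: polygon_def)

lemma polygon_linear:
  assumes "real n \<le> x" "x \<le> real n + 1"
  shows "polygon s x = polygon s (real n) + s n * (x - real n)"
proof (cases "x = real n + 1")
  case True
  have "polygon s (real m) = (\<Sum>i<m. s i)" for m
    by (simp add: polygon_def frac_def)
  from this[of n] this[of "Suc n"] True show ?thesis
    by (simp add: add.commute)
next
  case False
  with assms have "\<lfloor>x\<rfloor> = int n"
    by (simp add: floor_eq_iff)
  then show ?thesis
    by (simp add: polygon_def frac_def)
qed

definition delta_in :: "nat \<Rightarrow> nat \<Rightarrow> nat \<Rightarrow> nat \<Rightarrow> nat \<Rightarrow> nat \<Rightarrow> int" where
  "delta_in p b d u i n =
     (if \<exists>l::nat. int l < res d (int n) \<and>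
           [int p * int l = int n - int (digit p u (b - i))] (mod int d)
      then 1 else 0)"

definition interval_slope :: "nat \<Rightarrow> nat \<Rightarrow> nat \<Rightarrow> nat \<Rightarrow> nat \<Rightarrow> real" where
  "interval_slope p b d u n =
     1 / real b * (\<Sum>i=1..b. real_of_int
       (\<lceil>((real p - 1) * real n + real (digit p u (b - i))) / real d\<rceil> - delta_in p b d u i n))"

text \<open>The twisted arithmetic polygon of \<open>[0, d]\<close>.\<close>

definition interval_polygon :: "nat \<Rightarrow> nat \<Rightarrow> nat \<Rightarrow> nat \<Rightarrow> real \<Rightarrow> real" where
  "interval_polygon p b d u = polygon (interval_slope p b d u)"

text \<open>The inner sum over \<open>j\<close> in the slopes below. The argument \<open>a\<close> is an integer because it is
  also used at \<open>a - 1\<close> with \<open>a = 0\<close>, where \<open>r\<^sub>-\<^sub>1 = d - 1\<close>.\<close>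

definition crossing_sum :: "nat \<Rightarrow> nat \<Rightarrow> nat \<Rightarrow> nat \<Rightarrow> nat \<Rightarrow> nat \<Rightarrow> int \<Rightarrow> int" where
  "crossing_sum p b d k u i a =
     (\<Sum>j=0..res d a.
        of_bool (frac (real_of_int (twisted_res p b d u i j) / real k)
                   > frac (real_of_int (res d a) / real k))
      - of_bool (frac (real_of_int (res d j) / real k)
                   > frac (real_of_int (res d a) / real k)))"

definition point_interval_slope :: "nat \<Rightarrow> nat \<Rightarrow> nat \<Rightarrow> nat \<Rightarrow> nat \<Rightarrow> nat \<Rightarrow> real" where
  "point_interval_slope p b d k u a =
     1 / real b * (\<Sum>i=1..b. real_of_int
       (\<lfloor>(real p * real a + real (digit p u (b - i))) / real d\<rfloor>
        - \<lfloor>real a / real d\<rfloor>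
        + \<lfloor>real_of_int (twisted_res p b d u i (int a)) / real k\<rfloor>
        - \<lfloor>real_of_int (res d (int a)) / real k\<rfloor>))
     + 1 / real b * (\<Sum>i=1..b. real_of_int (crossing_sum p b d k u i (int a)))
     - 1 / real b * (\<Sum>i=1..b. real_of_int (crossing_sum p b d k u i (int a - 1)))"

text \<open>The twisted arithmetic polygon of \<open>{d} \<union> [0, k]\<close>.\<close>

definition point_interval_polygon ::
    "nat \<Rightarrow> nat \<Rightarrow> nat \<Rightarrow> nat \<Rightarrow> nat \<Rightarrow> real \<Rightarrow> real" where
  "point_interval_polygon p b d k u = polygon (point_interval_slope p b d k u)"

end

theory Submission
  imports Defs
begin

text \<open>
  Both polygons are linear between consecutive integers, so it suffices to compare their values at
  each integer \<open>M + 1\<close>, and this can be done separately for every \<open>i\<close>, that is, for every digit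
  \<open>v\<close> of \<open>u\<close>. Since \<open>p\<close> is prime to \<open>d\<close>, the map \<open>\<sigma> j = (p j + v) mod d\<close> permutes the residues
  \<open>{0, \<dots>, d - 1}\<close>.

  Both slopes at \<open>a\<close> contain the term \<open>\<lfloor>(p a + v)/d\<rfloor> - \<lfloor>a/d\<rfloor>\<close>. Apart from a difference of
  consecutive crossing sums, which telescopes to the crossing sum at \<open>M\<close>, what remains depends only
  on the residue of \<open>a\<close> and sums to zero over a full period, because \<open>\<sigma>\<close> is a permutation. So only
  the residues up to \<open>m = M mod d\<close> matter.
  \<^item> For the interval, what remains is \<open>[\<sigma> j > j]\<close> minus \<open>[\<sigma>\<^sup>-\<^sup>1 j < j]\<close>. Summed over \<open>j \<le> m\<close> it counts
    the \<open>j \<le> m\<close> that \<open>\<sigma>\<close> carries beyond \<open>m\<close>, since every other ascent \<open>j < \<sigma> j \<le> m\<close> occurs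
    once with each sign (\<open>sum_ascents_minus_ascent_targets\<close>).
  \<^item> For the point and the interval, what remains sums, together with the crossing sum, to
    \<open>\<Sum>\<^sub>j\<^sub>\<le>\<^sub>m (f (\<sigma> j) - f j)\<close>, with \<open>f x = x div k + [x mod k > m mod k]\<close>. This \<open>f\<close> is the step function
    \<open>m div k + \<lceil>(x - m)/k\<rceil>\<close>, so \<open>f x \<le> f m\<close> for \<open>x \<le> m\<close> and \<open>f x \<ge> f m + 1\<close> for \<open>x > m\<close>.
    Hence every \<open>j\<close> that leaves \<open>{0, \<dots>, m}\<close> contributes at least \<open>1\<close>
    (\<open>card_escapes_le_crossing\<close>).
\<close>

section \<open>Maps that leave an initial segment\<close>

text \<open>Elements common to \<open>J\<close> and its image cancel; the remaining ones come in equal numbers, with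
  values at least \<open>c + 1\<close> on the image side and at most \<open>c\<close> on the other.\<close>

lemma card_escapes_le_sum_diff:
  fixes f :: "'a \<Rightarrow> int"
  assumes "finite J" and inj: "inj_on \<sigma> J"
    and low: "\<And>x. x \<in> J \<Longrightarrow> f x \<le> c"
    and high: "\<And>x. x \<in> J \<Longrightarrow> \<sigma> x \<notin> J \<Longrightarrow> c + 1 \<le> f (\<sigma> x)"
  shows "int (card {x \<in> J. \<sigma> x \<notin> J}) \<le> (\<Sum>x\<in>J. f (\<sigma> x) - f x)"
proof -
  let ?g = "\<lambda>x. f x - c"
  let ?I = "\<sigma> ` J"
  have fin: "finite ?I"
    using assms(1) by simp
  have escapes: "?I - J = \<sigma> ` {x \<in> J. \<sigma> x \<notin> J}"
    by auto
  have "card (?I - J) = card {x \<in> J. \<sigma> x \<notin> J}"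
    unfolding escapes by (rule card_image) (rule inj_on_subset[OF inj], auto)
  moreover have "(\<Sum>y\<in>?I - J. 1) \<le> (\<Sum>y\<in>?I - J. ?g y)"
    by (rule sum_mono) (use high in force)
  moreover have "sum ?g ?I = sum ?g (?I \<inter> J) + sum ?g (?I - J)"
    by (rule sum.Int_Diff) (rule fin)
  moreover have "sum ?g J = sum ?g (J \<inter> ?I) + sum ?g (J - ?I)"
    by (rule sum.Int_Diff) (rule assms(1))
  moreover have "sum ?g (J - ?I) \<le> 0"
    by (rule sum_nonpos) (use low in force)
  moreover have "sum ?g ?I = (\<Sum>x\<in>J. ?g (\<sigma> x))"
    using sum.reindex[OF inj, of ?g] by simp
  moreover have "(\<Sum>x\<in>J. f (\<sigma> x) - f x) = (\<Sum>x\<in>J. ?g (\<sigma> x)) - sum ?g J"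
    by (simp add: sum_subtractf)
  ultimately show ?thesis
    by (simp add: Int_commute)
qed

text \<open>Adding the indicator turns \<open>x div k\<close> into a step function that jumps just after \<open>m\<close>, instead
  of at the multiples of \<open>k\<close>.\<close>

lemma shifted_div_le:
  fixes x m k :: int
  assumes "k > 0" "x \<le> m"
  shows "x div k + of_bool (m mod k < x mod k) \<le> m div k"
proof (cases "x div k = m div k")
  case True
  then have "x mod k \<le> m mod k"
    using assms(2) mult_div_mod_eq[of k x, unfolded True] mult_div_mod_eq[of k m] by linarith
  then show ?thesis
    using True by simp
next
  case False
  then show ?thesis
    using zdiv_mono1[OF assms(2,1)] by simp
qed

lemma shifted_div_gt:
  fixes x m k :: int
  assumes "k > 0" "m < x"
  shows "m div k + 1 \<le> x div k + of_bool (m mod k < x mod k)"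
proof (cases "x div k = m div k")
  case True
  then have "m mod k < x mod k"
    using assms(2) mult_div_mod_eq[of k x, unfolded True] mult_div_mod_eq[of k m] by linarith
  then show ?thesis
    using True by simp
next
  case False
  then show ?thesis
    using zdiv_mono1[of m x k] assms by simp
qed

lemma card_escapes_le_crossing:
  fixes \<sigma> :: "int \<Rightarrow> int" and m k :: int
  assumes "k > 0" "inj_on \<sigma> {0..m}" "\<And>j. 0 \<le> \<sigma> j"
  shows "int (card {j \<in> {0..m}. m < \<sigma> j}) \<le>
    (\<Sum>j=0..m. \<sigma> j div k - j div k)
    + (\<Sum>j=0..m. of_bool (m mod k < \<sigma> j mod k) - of_bool (m mod k < j mod k))"
proof -
  let ?f = "\<lambda>x. x div k + of_bool (m mod k < x mod k)"
  have "int (card {j \<in> {0..m}. \<sigma> j \<notin> {0..m}}) \<le> (\<Sum>j=0..m. ?f (\<sigma> j) - ?f j)"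
    by (rule card_escapes_le_sum_diff[where c = "m div k"])
      (use assms shifted_div_le shifted_div_gt in auto)
  moreover have "{j \<in> {0..m}. \<sigma> j \<notin> {0..m}} = {j \<in> {0..m}. m < \<sigma> j}"
    using assms(3) by auto
  ultimately show ?thesis
    by (simp add: sum.distrib sum_subtractf algebra_simps)
qed

text \<open>An ascent \<open>l < \<sigma> l \<le> m\<close> is counted once at \<open>j = l\<close> and subtracted once at \<open>j = \<sigma> l\<close>; only
  the ascents with \<open>\<sigma> l > m\<close> survive.\<close>

lemma sum_ascents_minus_ascent_targets:
  fixes \<sigma> :: "int \<Rightarrow> int" and m :: int
  assumes inj: "inj_on \<sigma> {0..m}"
  shows "(\<Sum>j=0..m. of_bool (j < \<sigma> j) - of_bool (\<exists>l\<in>{0..<j}. \<sigma> l = j))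
    = int (card {j \<in> {0..m}. m < \<sigma> j})"
proof -
  let ?inner = "{l \<in> {0..m}. l < \<sigma> l \<and> \<sigma> l \<le> m}"
  let ?outer = "{j \<in> {0..m}. m < \<sigma> j}"
  have "{j \<in> {0..m}. \<exists>l\<in>{0..<j}. \<sigma> l = j} = \<sigma> ` ?inner"
    by force
  moreover have "card (\<sigma> ` ?inner) = card ?inner"
    by (rule card_image) (rule inj_on_subset[OF inj], auto)
  ultimately have targets: "card {j \<in> {0..m}. \<exists>l\<in>{0..<j}. \<sigma> l = j} = card ?inner"
    by simp
  have "{j \<in> {0..m}. j < \<sigma> j} = ?inner \<union> ?outer"
    by auto
  moreover have "card (?inner \<union> ?outer) = card ?inner + card ?outer"
  proof (rule card_Un_disjoint)
    show "finite ?inner" "finite ?outer"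
      by (rule finite_subset[of _ "{0..m}"]; auto)+
  qed auto
  ultimately have "card {j \<in> {0..m}. j < \<sigma> j} = card ?inner + card ?outer"
    by simp
  then show ?thesis
    using targets by (simp add: sum_subtractf of_bool_def flip: sum.inter_filter)
qed

section \<open>Periodic summation\<close>

lemma sum_periodic_mod:
  fixes h :: "nat \<Rightarrow> int"
  assumes periodic: "\<And>a. h (a + d) = h a" and zero: "(\<Sum>a<d. h a) = 0"
  shows "(\<Sum>a<Suc M. h a) = (\<Sum>a<Suc (M mod d). h a)"
proof -
  have periodic': "h (d + a) = h a" for a
    using periodic[of a] by (simp add: add.commute)
  have "(\<Sum>a<q * d + t. h a) = (\<Sum>a<t. h a)" for q t
  proof (induction q)
    case (Suc q)
    have "(\<Sum>a<d + n. h a) = (\<Sum>a<d. h a) + (\<Sum>a<n. h (d + a))" for n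
      by (induction n) (simp_all add: add.assoc)
    then show ?case
      using Suc zero by (simp add: periodic' add.assoc)
  qed simp
  from this[of "M div d" "Suc (M mod d)"] show ?thesis
    by simp
qed

lemma sum_lessThan_int:
  fixes h :: "int \<Rightarrow> int"
  shows "(\<Sum>a<n. h (int a)) = (\<Sum>j=0..int n - 1. h j)"
  by (rule sum.reindex_bij_witness[of _ nat int]) auto

lemma sum_point_difference:
  fixes c :: "int \<Rightarrow> int"
  shows "(\<Sum>a<Suc M. c (int a) - c (int a - 1)) = c (int M) - c (-1)"
  by (induction M) simp_all

section \<open>Residues of an affine map\<close>

lemma bij_betw_affine_mod:
  fixes p v d :: int
  assumes "coprime p d" "d > 0"
  shows "bij_betw (\<lambda>j. (p * j + v) mod d) {0..<d} {0..<d}"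
proof -
  let ?\<sigma> = "\<lambda>j. (p * j + v) mod d"
  have "inj_on ?\<sigma> {0..<d}"
  proof (rule inj_onI)
    fix x y assume xy: "x \<in> {0..<d}" "y \<in> {0..<d}" and "?\<sigma> x = ?\<sigma> y"
    then have "[p * x = p * y] (mod d)"
      by (metis cong_add_rcancel cong_def)
    then have "[x = y] (mod d)"
      using assms(1) cong_mult_lcancel by blast
    then show "x = y"
      using xy by (simp add: cong_def)
  qed
  moreover have "?\<sigma> ` {0..<d} = {0..<d}"
    by (rule endo_inj_surj) (use calculation assms in auto)
  ultimately show ?thesis
    by (simp add: bij_betw_def)
qed

lemma ceiling_diff_div:
  fixes x y :: int
  assumes "d > 0"
  shows "\<lceil>(real_of_int x - real_of_int y) / real d\<rceil>
    = x div int d - y div int d + of_bool (y mod int d < x mod int d)"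
proof -
  let ?D = "real d"
  have x: "real_of_int x = ?D * real_of_int (x div int d) + real_of_int (x mod int d)"
    by (metis mult_div_mod_eq of_int_add of_int_mult of_int_of_nat_eq)
  have y: "real_of_int y = ?D * real_of_int (y div int d) + real_of_int (y mod int d)"
    by (metis mult_div_mod_eq of_int_add of_int_mult of_int_of_nat_eq)
  define e where "e = real_of_int (x mod int d - y mod int d) / ?D"
  have bound: "0 \<le> real_of_int (z mod int d) \<and> real_of_int (z mod int d) < ?D" for z
    using assms by (metis of_int_0_le_iff of_int_less_iff of_int_of_nat_eq of_nat_0_less_iff
        pos_mod_bound pos_mod_sign)
  have "\<lceil>e\<rceil> = of_bool (y mod int d < x mod int d)"
  proof (cases "y mod int d < x mod int d")
    case True
    then show ?thesis
      using assms bound[of x] bound[of y] by (simp add: ceiling_eq_iff e_def field_simps)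
  next
    case False
    moreover have "real_of_int (y mod int d) < ?D + real_of_int (x mod int d)"
      using bound[of x] bound[of y] by linarith
    ultimately show ?thesis
      using assms by (simp add: ceiling_eq_iff e_def field_simps)
  qed
  moreover have "(real_of_int x - real_of_int y) / ?D = e + of_int (x div int d - y div int d)"
    unfolding e_def by (subst x, subst y) (use assms in \<open>simp add: field_simps\<close>)
  ultimately show ?thesis
    by (simp only: ceiling_add_of_int)
qed

lemma frac_div_less_iff:
  assumes "k > 0"
  shows "frac (real_of_int x / real k) < frac (real_of_int y / real k)
    \<longleftrightarrow> x mod int k < y mod int k"
proof -
  have "real_of_int (x mod int k) < real_of_int (y mod int k)
    \<longleftrightarrow> frac (real_of_int x / real k) < frac (real_of_int y / real k)"
    using res_eq_frac[OF assms, of x] res_eq_frac[OF assms, of y] assms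
    unfolding res_def by simp
  then show ?thesis
    by simp
qed

section \<open>Comparison of the polygons\<close>

text \<open>The value of a polygon is an interpolation of its values at the two neighbouring integers.\<close>

lemma polygon_mono:
  assumes le: "\<And>N. (\<Sum>n<N. s n) \<le> (\<Sum>n<N. t n)"
  shows "polygon s x \<le> polygon t x"
proof -
  let ?n = "nat \<lfloor>x\<rfloor>" and ?e = "frac x"
  have interp: "polygon w x = (1 - ?e) * (\<Sum>n<?n. w n) + ?e * (\<Sum>n<Suc ?n. w n)" for w
    by (simp add: polygon_def algebra_simps)
  have "0 \<le> ?e" "?e \<le> 1"
    by (simp_all add: less_imp_le[OF frac_lt_1])
  then show ?thesis
    unfolding interp by (intro add_mono mult_left_mono le) simp_all
qed

text \<open>The condition in \<open>delta_in\<close> says that the preimage of the residue of \<open>n\<close> under the permutation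
  lies below that residue.\<close>

lemma delta_in_eq:
  assumes "d > 0"
  shows "delta_in p b d u i n
    = of_bool (\<exists>l\<in>{0..<int n mod int d}. twisted_res p b d u i l = int n mod int d)"
proof -
  have "[int p * l = int n - v] (mod int d) \<longleftrightarrow> (int p * l + v) mod int d = int n mod int d" for l v
    by (metis cong_def cong_add_rcancel diff_add_cancel)
  then have "(\<exists>l::nat. int l < res d (int n) \<and>
           [int p * int l = int n - int (digit p u (b - i))] (mod int d)) \<longleftrightarrow>
      (\<exists>l\<in>{0..<int n mod int d}. twisted_res p b d u i l = int n mod int d)"
    unfolding res_def twisted_res_def
    by (metis atLeastLessThan_iff nonneg_int_cases of_nat_0_le_iff)
  then show ?thesis
    by (simp add: delta_in_def)
qed

text \<open>The two sums differ by the telescoping crossing sums, which vanish at \<open>-1\<close>, and by a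
  \<open>d\<close>-periodic function \<open>h\<close> with sum zero over a period. For \<open>N = M + 1\<close> this leaves the crossing
  sum at \<open>M\<close> and the values of \<open>h\<close> at the residues up to \<open>M mod d\<close>, where
  \<open>card_escapes_le_crossing\<close> applies.\<close>

lemma digit_slope_sum_le:
  fixes p b d k u i :: nat
  assumes "coprime p d" "d > 0" "k > 0"
  shows "(\<Sum>n<N. \<lceil>((real p - 1) * real n + real (digit p u (b - i))) / real d\<rceil>
        - delta_in p b d u i n)
    \<le> (\<Sum>a<N. \<lfloor>(real p * real a + real (digit p u (b - i))) / real d\<rfloor>
        - \<lfloor>real a / real d\<rfloor>
        + \<lfloor>real_of_int (twisted_res p b d u i (int a)) / real k\<rfloor>
        - \<lfloor>real_of_int (res d (int a)) / real k\<rfloor>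
        + (crossing_sum p b d k u i (int a) - crossing_sum p b d k u i (int a - 1)))"
    (is "(\<Sum>n<N. ?s n) \<le> (\<Sum>a<N. ?t a)")
proof (cases N)
  case (Suc M)
  define v where "v = int (digit p u (b - i))"
  define \<sigma> where "\<sigma> = twisted_res p b d u i"
  define D where "D = int d"
  define K where "K = int k"
  define c where "c = crossing_sum p b d k u i"
  have pos: "D > 0" "K > 0"
    using assms by (simp_all add: D_def K_def)
  have \<sigma>: "\<sigma> j = (int p * j + v) mod D" for j
    by (simp add: \<sigma>_def twisted_res_def res_def v_def D_def)
  have \<sigma>_nonneg: "0 \<le> \<sigma> j" and \<sigma>_less: "\<sigma> j < D" for j
    using pos by (simp_all add: \<sigma>)
  have \<sigma>_mod: "\<sigma> (j mod D) = \<sigma> j" for j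
    by (metis \<sigma> mod_add_left_eq mod_mult_right_eq)
  have bij: "bij_betw \<sigma> {0..D - 1} {0..D - 1}"
  proof -
    have "{0..D - 1} = {0..<D}"
      by auto
    moreover have "coprime (int p) D"
      using assms(1) by (simp add: D_def)
    ultimately show ?thesis
      using bij_betw_affine_mod[of "int p" D v] pos(1) by (simp add: \<sigma>[abs_def])
  qed
  have permute: "(\<Sum>j=0..D - 1. g (\<sigma> j)) = (\<Sum>j=0..D - 1. g j)" for g :: "int \<Rightarrow> int"
    by (rule sum.reindex_bij_betw[OF bij])
  have inj: "inj_on \<sigma> {0..m}" if "m < D" for m
    by (rule inj_on_subset[OF bij_betw_imp_inj_on[OF bij]]) (use that in auto)

  have c: "c a = (\<Sum>j=0..a mod D. of_bool (a mod D mod K < \<sigma> j mod K)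
      - of_bool (a mod D mod K < j mod K))" for a
  proof -
    have "j mod D = j" if "j \<in> {0..a mod D}" for j
      using that pos_mod_bound[OF pos(1), of a] by (intro mod_pos_pos_trivial) auto
    then show ?thesis
      unfolding c_def crossing_sum_def frac_div_less_iff[OF assms(3)] K_def[symmetric]
        \<sigma>_def[symmetric] res_def D_def[symmetric]
      by (intro sum.cong) auto
  qed
  \<comment> \<open>At \<open>-1\<close> the residue is \<open>d - 1\<close>, and the sum runs over the whole period.\<close>
  have c_minus_one: "c (-1) = 0"
  proof -
    have "(-1) mod D = D - 1"
      using pos(1) by (simp add: zmod_minus1)
    then show ?thesis
      using permute[of "\<lambda>j. of_bool ((D - 1) mod K < j mod K)"]
      by (simp add: c sum_subtractf)
  qed

  define g where "g j = \<sigma> j div K - j div K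
      - (of_bool (j < \<sigma> j) - of_bool (\<exists>l\<in>{0..<j}. \<sigma> l = j))" for j
  define h where "h a = g (int a mod D)" for a
  have slopes: "?t a - ?s a = h a + (c (int a) - c (int a - 1))" for a
  proof -
    have "\<lceil>((real p - 1) * real a + real (digit p u (b - i))) / real d\<rceil>
      = (int p * int a + v) div D - int a div D + of_bool (int a mod D < \<sigma> (int a))"
      using ceiling_diff_div[OF assms(2), of "int p * int a + v" "int a"]
      by (simp add: \<sigma> D_def v_def algebra_simps)
    moreover have "\<lfloor>(real p * real a + real (digit p u (b - i))) / real d\<rfloor>
      = (int p * int a + v) div D"
      using floor_divide_of_int_eq[of "int p * int a + v" D, where 'a = real]
      by (simp add: D_def v_def)
    moreover have "\<lfloor>real a / real d\<rfloor> = int a div D"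
      using floor_divide_of_int_eq[of "int a" D, where 'a = real] by (simp add: D_def)
    moreover have "\<lfloor>real_of_int x / real k\<rfloor> = x div K" for x
      using floor_divide_of_int_eq[of x K, where 'a = real] by (simp add: K_def)
    ultimately show ?thesis
      by (simp add: h_def g_def \<sigma>_mod delta_in_eq[OF assms(2)] res_def
          flip: \<sigma>_def D_def c_def)
  qed

  have sum_h: "(\<Sum>a<n. h a) = (\<Sum>j=0..int n - 1. g j)" if "n \<le> d" for n
  proof -
    have "(\<Sum>a<n. h a) = (\<Sum>a<n. g (int a))"
      using that by (intro sum.cong) (auto simp: h_def D_def)
    then show ?thesis
      by (simp add: sum_lessThan_int)
  qed
  have sum_g: "(\<Sum>j=0..m. g j)
      = (\<Sum>j=0..m. \<sigma> j div K - j div K) - int (card {j \<in> {0..m}. m < \<sigma> j})" if "m < D" for m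
    unfolding g_def sum_subtractf[of _ _ "{0..m}"]
    using sum_ascents_minus_ascent_targets[OF inj[OF that]] by (simp add: sum_subtractf)
  have "(\<Sum>a<d. h a) = 0"
  proof -
    have "\<not> D - 1 < \<sigma> j" for j
      using \<sigma>_less[of j] by linarith
    then show ?thesis
      using sum_h[of d] sum_g[of "D - 1"] permute[of "\<lambda>j. j div K"]
      by (simp add: sum_subtractf flip: D_def)
  qed
  moreover have "h (a + d) = h a" for a
    by (simp add: h_def D_def)
  ultimately have "(\<Sum>a<N. h a) = (\<Sum>a<Suc (M mod d). h a)"
    unfolding Suc by (rule sum_periodic_mod[rotated])
  also have "\<dots> = (\<Sum>j=0..int M mod D. g j)"
    using sum_h[of "Suc (M mod d)"] assms(2) by (simp add: D_def Suc_leI zmod_int)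
  finally have "(\<Sum>a<N. ?t a - ?s a) = (\<Sum>j=0..int M mod D. g j) + c (int M)"
    using sum_point_difference[of c M] c_minus_one
    by (simp add: slopes sum.distrib Suc del: sum.lessThan_Suc)
  also have "\<dots> \<ge> 0"
    using card_escapes_le_crossing[OF pos(2) inj \<sigma>_nonneg, of "int M mod D"]
      sum_g[of "int M mod D"] pos(1) by (simp add: c)
  finally show ?thesis
    by (simp only: sum_subtractf)
qed simp

theorem theorem1p9:
  fixes p b d k u :: nat
  assumes "prime p"
    and "\<not> p dvd d"
    and "b \<ge> 1"
    and "1 \<le> k" and "k \<le> d - 1"
    and "1 \<le> u" and "u \<le> p ^ b - 1"
    and "convex_on {0..} (interval_polygon p b d u)"
    and "convex_on {0..} (point_interval_polygon p b d k u)"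
  shows "\<forall>x\<ge>0. point_interval_polygon p b d k u x \<ge> interval_polygon p b d u x"
proof (intro allI impI)
  fix x :: real
  let ?s = "\<lambda>i n. \<lceil>((real p - 1) * real n + real (digit p u (b - i))) / real d\<rceil>
        - delta_in p b d u i n"
  let ?t = "\<lambda>i a. \<lfloor>(real p * real a + real (digit p u (b - i))) / real d\<rfloor>
        - \<lfloor>real a / real d\<rfloor>
        + \<lfloor>real_of_int (twisted_res p b d u i (int a)) / real k\<rfloor>
        - \<lfloor>real_of_int (res d (int a)) / real k\<rfloor>
        + (crossing_sum p b d k u i (int a) - crossing_sum p b d k u i (int a - 1))"
  have hyps: "coprime p d" "d > 0" "k > 0"
    using assms(1,2,4,5) by (auto intro: prime_imp_coprime)
  have interval: "interval_slope p b d u n = 1 / real b * (\<Sum>i=1..b. real_of_int (?s i n))" for n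
    by (simp add: interval_slope_def)
  have point_interval:
    "point_interval_slope p b d k u n = 1 / real b * (\<Sum>i=1..b. real_of_int (?t i n))" for n
    unfolding point_interval_slope_def
    by (simp add: sum.distrib sum_subtractf ring_distribs diff_divide_distrib add_divide_distrib)
  have exchange: "(\<Sum>n<N. 1 / real b * (\<Sum>i=1..b. real_of_int (w i n)))
      = 1 / real b * (\<Sum>i=1..b. real_of_int (\<Sum>n<N. w i n))" for w :: "nat \<Rightarrow> nat \<Rightarrow> int" and N
    unfolding of_int_sum sum_distrib_left by (rule sum.swap)
  have "(\<Sum>n<N. interval_slope p b d u n) \<le> (\<Sum>n<N. point_interval_slope p b d k u n)" for N
    unfolding interval point_interval exchange[of ?s] exchange[of ?t]
    by (intro mult_left_mono sum_mono) (simp_all only: of_int_le_iff digit_slope_sum_le[OF hyps], simp)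
  then show "interval_polygon p b d u x \<le> point_interval_polygon p b d k u x"
    unfolding interval_polygon_def point_interval_polygon_def by (rule polygon_mono)
qed

end
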